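(* Let $\mathbb{X}$ be a smooth real Banach space, let $T \in \mathbb{L}(\mathbb{X})$ and let $x \in M_T$. Then for any $y \in \mathbb{X}$, $x \perp_B y \Leftrightarrow Tx \perp_B Ty$.
   Context: $\mathbb{L}(\mathbb{X})$ is the space of bounded linear operators on $\mathbb{X}$. $S_{\mathbb{X}} = \{x \in \mathbb{X} : \|x\| = 1\}$ and $M_T = \{x \in S_{\mathbb{X}} : \|Tx\| = \|T\|\}$. For $x,y \in \mathbb{X}$, $x \perp_B y$ (Birkhoff-James orthogonality) means $\|x\| \le \|x + \lambda y\|$ for all $\lambda \in \mathbb{R}$. A Banach space is smooth if each point $x$ of its unit sphere has a unique norm-one functional $f$ with $f(x) = 1$.
   Formalization: The operator T is assumed to be nonzero; for T = 0 the claim fails, since every unit vector x lies in M_T and Tx ⊥_B Tx holds trivially while x ⊥_B x does not. *)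

theory Defs
  imports "HOL-Analysis.Analysis"
begin

definition birkhoff_james_orthogonal :: "'a::real_normed_vector \<Rightarrow> 'a \<Rightarrow> bool"
    (infix "\<bottom>\<^sub>B" 50) where
  "x \<bottom>\<^sub>B y \<longleftrightarrow> (\<forall>t::real. norm x \<le> norm (x + t *\<^sub>R y))"

definition norm_attainment_set ::
    "('a::real_normed_vector \<Rightarrow>\<^sub>L 'b::real_normed_vector) \<Rightarrow> 'a set" where
  "norm_attainment_set T = {x \<in> sphere 0 1. norm (blinfun_apply T x) = norm T}"

(* Smoothness is a property of the whole space, which is here the carrier of a type;
   the space is passed as the type argument, in the style of CARD('a). *)
definition smooth_space :: "'a::real_normed_vector itself \<Rightarrow> bool" where
  "smooth_space (_ :: 'a itself) \<longleftrightarrow>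
     (\<forall>x \<in> sphere (0::'a) 1. \<exists>!f :: 'a \<Rightarrow>\<^sub>L real. norm f = 1 \<and> blinfun_apply f x = 1)"

end

theory Submission
  imports Defs
begin

text \<open>
  Let \<open>x\<close> attain the norm of \<open>T\<close>. If \<open>T x \<bottom>\<^sub>B T y\<close>, then
  \<open>\<parallel>T\<parallel> = \<parallel>T x\<parallel> \<le> \<parallel>T (x + t y)\<parallel> \<le> \<parallel>T\<parallel> \<parallel>x + t y\<parallel>\<close>, and dividing by \<open>\<parallel>T\<parallel>\<close> gives \<open>x \<bottom>\<^sub>B y\<close>.

  Conversely, orthogonality is read off from support functionals, the norm-one functionals that
  take the value one at a given unit vector. If some support functional at a unit vector
  annihilates \<open>y\<close>, then that vector is orthogonal to \<open>y\<close>; in a smooth space the converse holds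
  for the unique support functional (\<open>orthogonal_imp_support_functional_zero\<close>). Let \<open>g\<close> be the support
  functional at \<open>T x / \<parallel>T\<parallel>\<close>. Because \<open>x\<close> attains the norm, \<open>g \<circ> T / \<parallel>T\<parallel>\<close> is the support functional at
  \<open>x\<close>. So \<open>x \<bottom>\<^sub>B y\<close> forces \<open>g (T y) = 0\<close>, which in turn gives \<open>T x \<bottom>\<^sub>B T y\<close>.

  The criterion rests on compactness. Smoothness provides support functionals at the normalised
  points \<open>x + t y\<close>, and as \<open>t > 0\<close> tends to zero these have a weak-star cluster point by the
  Banach-Alaoglu theorem (\<open>compact_dominated_linear_functionals\<close>). It is a support functional at
  \<open>x\<close> that is nonnegative at \<open>y\<close>; the same for \<open>- y\<close>, together with uniqueness, makes the
  support functional at \<open>x\<close> vanish at \<open>y\<close>.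
\<close>

text \<open>
  This is the Banach-Alaoglu theorem, with functionals as points of the product space
  \<open>'a \<Rightarrow> real\<close>: the dominated functions form a product of compact intervals, and linearity is a
  conjunction of equations between coordinates, hence a closed condition.
\<close>

lemma compact_dominated_linear_functionals:
  "compact {h :: 'a::real_normed_vector \<Rightarrow> real. linear h \<and> (\<forall>z. \<bar>h z\<bar> \<le> norm z)}"
proof -
  have "compactin (product_topology (\<lambda>_. euclidean) UNIV)
          (\<Pi>\<^sub>E z\<in>UNIV. {- norm z .. norm (z::'a)})"
    by (subst compactin_PiE) auto
  then have box: "compact (\<Pi>\<^sub>E z\<in>UNIV. {- norm z .. norm (z::'a)})"
    by (simp add: euclidean_product_topology)
  have coord: "continuous_on UNIV (\<lambda>h :: 'a \<Rightarrow> real. h z)" for z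
    by simp
  have "closed {h :: 'a \<Rightarrow> real.
      (\<forall>u v. h (u + v) = h u + h v) \<and> (\<forall>r u. h (r *\<^sub>R u) = r * h u)}"
    by (intro closed_Collect_conj closed_Collect_all closed_Collect_eq continuous_intros coord)
  then have "closed {h :: 'a \<Rightarrow> real. linear h}"
    by (simp add: linear_iff)
  from compact_Int_closed [OF box this] show ?thesis
    by (rule back_subst [where P = compact]) (auto simp: PiE_UNIV_domain abs_le_iff minus_le_iff)
qed

lemma blinfun_of_dominated_linear:
  fixes h :: "'a::real_normed_vector \<Rightarrow> real"
  assumes "linear h" and "\<And>z. \<bar>h z\<bar> \<le> norm z" and "h x = 1" and "norm x = 1"
  obtains f :: "'a \<Rightarrow>\<^sub>L real" where "norm f = 1" and "\<And>z. f z = h z"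
proof -
  have "bounded_linear h"
    using assms(1,2)
    by (intro bounded_linear_intro [where K = 1]) (auto simp: linear_add linear_scale)
  then have eq: "blinfun_apply (Blinfun h) z = h z" for z
    by (simp add: bounded_linear_Blinfun_apply)
  have "norm (Blinfun h) \<le> 1"
    using assms(2) by (intro norm_blinfun_bound) (auto simp: eq)
  moreover have "1 \<le> norm (Blinfun h)"
    using norm_blinfun [of "Blinfun h" x] assms(3,4) by (simp add: eq)
  ultimately show ?thesis
    using that [of "Blinfun h"] eq by simp
qed

lemma smooth_space_ex_support_functional:
  fixes z :: "'a::real_normed_vector"
  assumes "smooth_space TYPE('a)" and "z \<noteq> 0"
  obtains f :: "'a \<Rightarrow>\<^sub>L real" where "norm f = 1" and "f z = norm z"
proof -
  have "z /\<^sub>R norm z \<in> sphere 0 1"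
    using assms(2) by simp
  then obtain f :: "'a \<Rightarrow>\<^sub>L real" where "norm f = 1" and "f (z /\<^sub>R norm z) = 1"
    using assms(1) unfolding smooth_space_def by blast
  with that assms(2) show ?thesis
    by (simp add: blinfun.scaleR_right field_simps)
qed

lemma abs_norm_one_functional_le:
  fixes f :: "'a::real_normed_vector \<Rightarrow>\<^sub>L real"
  assumes "norm f = 1"
  shows "\<bar>f z\<bar> \<le> norm z"
  using norm_blinfun [of f z] assms by simp

text \<open>
  With \<open>t > 0\<close>, a support functional \<open>f\<close> at the normalisation of \<open>x + t y\<close> satisfies
  \<open>1 \<le> \<parallel>x + t y\<parallel> = f x + t f y\<close>. From \<open>f x \<le> 1\<close> it follows that \<open>f y \<ge> 0\<close>, and from
  \<open>f y \<le> \<parallel>y\<parallel>\<close> that \<open>f x \<ge> 1 - t \<parallel>y\<parallel>\<close>. Both bounds survive the limit \<open>t \<rightarrow> 0\<close>.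
\<close>

lemma orthogonal_imp_ex_support_functional_nonneg:
  fixes x y :: "'a::real_normed_vector"
  assumes "smooth_space TYPE('a)" and x: "norm x = 1" and orth: "x \<bottom>\<^sub>B y"
  obtains f :: "'a \<Rightarrow>\<^sub>L real" where "norm f = 1" and "f x = 1" and "0 \<le> f y"
proof -
  define K where "K = {h :: 'a \<Rightarrow> real. linear h \<and> (\<forall>z. \<bar>h z\<bar> \<le> norm z)}"
  define C where "C t = {h :: 'a \<Rightarrow> real. 0 \<le> h y \<and> 1 - t * norm y \<le> h x}" for t
  have nonempty: "\<exists>h. h \<in> K \<inter> C t" if "0 < t" for t
  proof -
    have ge1: "1 \<le> norm (x + t *\<^sub>R y)"
      using orth x by (auto simp: birkhoff_james_orthogonal_def)
    then have "x + t *\<^sub>R y \<noteq> 0"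
      by auto
    then obtain f :: "'a \<Rightarrow>\<^sub>L real"
      where f: "norm f = 1" and val: "f (x + t *\<^sub>R y) = norm (x + t *\<^sub>R y)"
      using smooth_space_ex_support_functional [OF assms(1)] by blast
    have sum: "1 \<le> f x + t * f y"
      using ge1 val by (simp add: blinfun.add_right blinfun.scaleR_right)
    have "f x \<le> 1" and "f y \<le> norm y"
      using abs_norm_one_functional_le [OF f, of x] abs_norm_one_functional_le [OF f, of y] x
      by auto
    then have "0 \<le> t * f y" and "t * f y \<le> t * norm y"
      using sum that by auto
    then have "0 \<le> f y" and "1 - t * norm y \<le> f x"
      using sum that by (simp add: zero_le_mult_iff, linarith)
    then have "blinfun_apply f \<in> C t"
      by (simp add: C_def)
    moreover have "blinfun_apply f \<in> K"
      using abs_norm_one_functional_le [OF f]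
      by (auto simp: K_def intro: bounded_linear.linear blinfun.bounded_linear_right)
    ultimately show ?thesis
      by blast
  qed
  have "K \<inter> (\<Inter>t\<in>{0<..}. C t) \<noteq> {}"
  proof (rule compact_imp_fip_image)
    show "compact K"
      unfolding K_def by (rule compact_dominated_linear_functionals)
    show "closed (C t)" for t
      unfolding C_def by (intro closed_Collect_conj closed_Collect_le continuous_intros) auto
    fix I :: "real set"
    assume I: "finite I" "I \<subseteq> {0<..}"
    \<comment> \<open>The sets \<open>C t\<close> shrink with \<open>t\<close>; inserting 1 covers the empty family.\<close>
    define m where "m = Min (insert 1 I)"
    have "0 < m" and le: "\<And>t. t \<in> I \<Longrightarrow> m \<le> t"
      using I by (auto simp: m_def)
    then obtain h where h: "h \<in> K" "h \<in> C m"
      using nonempty by blast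
    have "h \<in> C t" if "t \<in> I" for t
      using h(2) mult_right_mono [OF le [OF that] norm_ge_zero [of y]] by (auto simp: C_def)
    with h show "K \<inter> (\<Inter>t\<in>I. C t) \<noteq> {}"
      by blast
  qed
  then obtain h where h: "h \<in> K" "\<And>t. 0 < t \<Longrightarrow> h \<in> C t"
    by auto
  have "((\<lambda>t. 1 - t * norm y) \<longlongrightarrow> 1 - 0 * norm y) (at_right 0)"
    by (intro tendsto_intros)
  moreover have "\<forall>\<^sub>F t in at_right 0. 1 - t * norm y \<le> h x"
    using h(2) by (auto simp: C_def eventually_at_right_less intro!: eventually_at_rightI [of 0 1])
  ultimately have "1 \<le> h x"
    using tendsto_upperbound by fastforce
  moreover have "\<bar>h x\<bar> \<le> 1"
    using h(1) x unfolding K_def by (metis (mono_tags, lifting) mem_Collect_eq)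
  ultimately have "h x = 1"
    by simp
  then obtain f :: "'a \<Rightarrow>\<^sub>L real" where "norm f = 1" and "\<And>z. f z = h z"
    using blinfun_of_dominated_linear [of h x] h(1) x unfolding K_def by auto
  with that \<open>h x = 1\<close> h(2) [of 1] show ?thesis
    by (auto simp: C_def)
qed

lemma orthogonal_minus_right:
  assumes "x \<bottom>\<^sub>B y"
  shows "x \<bottom>\<^sub>B - y"
  unfolding birkhoff_james_orthogonal_def
proof
  fix t :: real
  show "norm x \<le> norm (x + t *\<^sub>R - y)"
    using assms [unfolded birkhoff_james_orthogonal_def, rule_format, of "- t"] by simp
qed

lemma orthogonal_imp_support_functional_zero:
  fixes x y :: "'a::real_normed_vector" and f :: "'a \<Rightarrow>\<^sub>L real"
  assumes smooth: "smooth_space TYPE('a)" and x: "norm x = 1" and orth: "x \<bottom>\<^sub>B y"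
    and f: "norm f = 1" "f x = 1"
  shows "f y = 0"
proof -
  have unique: "g = f" if "norm g = 1" "g x = 1" for g :: "'a \<Rightarrow>\<^sub>L real"
  proof -
    have "x \<in> sphere 0 1"
      using x by simp
    with smooth have "\<exists>!f :: 'a \<Rightarrow>\<^sub>L real. norm f = 1 \<and> blinfun_apply f x = 1"
      unfolding smooth_space_def by blast
    with f that show ?thesis
      by blast
  qed
  have nonneg: "0 \<le> f z" if "x \<bottom>\<^sub>B z" for z
    using orthogonal_imp_ex_support_functional_nonneg [OF smooth x that] unique by metis
  show ?thesis
    using nonneg [OF orth] nonneg [OF orthogonal_minus_right [OF orth]]
    by (simp add: blinfun.minus_right)
qed

lemma norming_functional_zero_imp_orthogonal:
  fixes u v :: "'a::real_normed_vector" and g :: "'a \<Rightarrow>\<^sub>L real"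
  assumes "norm g = 1" and "g u = norm u" and "g v = 0"
  shows "u \<bottom>\<^sub>B v"
  unfolding birkhoff_james_orthogonal_def
proof
  fix t :: real
  have "norm u = g (u + t *\<^sub>R v)"
    using assms by (simp add: blinfun.add_right blinfun.scaleR_right)
  also have "\<dots> \<le> norm (u + t *\<^sub>R v)"
    using abs_norm_one_functional_le [OF assms(1)] abs_le_D1 by blast
  finally show "norm u \<le> norm (u + t *\<^sub>R v)" .
qed

theorem theorem2p3:
  fixes T :: "'a::banach \<Rightarrow>\<^sub>L 'a" and x :: 'a
  assumes "smooth_space TYPE('a)"
    and "T \<noteq> 0"
    and "x \<in> norm_attainment_set T"
  shows "\<forall>y::'a. x \<bottom>\<^sub>B y \<longleftrightarrow> blinfun_apply T x \<bottom>\<^sub>B blinfun_apply T y"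
proof (intro allI iffI)
  have x: "norm x = 1" and Tx: "norm (T x) = norm T"
    using assms(3) by (auto simp: norm_attainment_set_def)
  have T: "0 < norm T"
    using assms(2) by simp
  fix y
  show "x \<bottom>\<^sub>B y" if orth: "T x \<bottom>\<^sub>B T y"
    unfolding birkhoff_james_orthogonal_def
  proof
    fix t :: real
    have "norm T * norm x \<le> norm (T x + t *\<^sub>R T y)"
      using orth Tx x by (simp add: birkhoff_james_orthogonal_def)
    also have "\<dots> \<le> norm T * norm (x + t *\<^sub>R y)"
      using norm_blinfun [of T "x + t *\<^sub>R y"]
      by (simp add: blinfun.add_right blinfun.scaleR_right)
    finally show "norm x \<le> norm (x + t *\<^sub>R y)"
      using T by simp
  qed
  show "T x \<bottom>\<^sub>B T y" if orth: "x \<bottom>\<^sub>B y"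
  proof -
    have "T x \<noteq> 0"
      using Tx T by auto
    then obtain g :: "'a \<Rightarrow>\<^sub>L real" where g: "norm g = 1" "g (T x) = norm (T x)"
      using smooth_space_ex_support_functional [OF assms(1)] by blast
    define h where "h z = g (T z) / norm T" for z
    have "linear h"
      by (rule linearI)
        (simp_all add: h_def blinfun.add_right blinfun.scaleR_right add_divide_distrib)
    moreover have "\<bar>h z\<bar> \<le> norm z" for z
    proof -
      have "\<bar>g (T z)\<bar> \<le> norm T * norm z"
        using abs_norm_one_functional_le [OF g(1), of "T z"] norm_blinfun [of T z] by linarith
      then show ?thesis
        using T by (simp add: h_def field_simps)
    qed
    moreover have hx: "h x = 1"
      using g(2) Tx T by (simp add: h_def)
    ultimately obtain f :: "'a \<Rightarrow>\<^sub>L real" where f: "norm f = 1" "\<And>z. f z = h z"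
      using blinfun_of_dominated_linear x by blast
    have "h y = 0"
      using orthogonal_imp_support_functional_zero [OF assms(1) x orth f(1)] f(2) hx by simp
    then have "g (T y) = 0"
      using T by (simp add: h_def)
    with g show ?thesis
      by (rule norming_functional_zero_imp_orthogonal)
  qed
qed

end
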